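(* For all $m,n\ge 1$ and $d\in\mathbb{N}$, the linear span $\langle \mathrm{hMPS}(m,n,d)\rangle\subseteq(\mathbb{C}^n)^{\otimes d}$ of the variety of homogeneous matrix product states has dimension equal to $\dim \mathcal{M}_{m,n;d}$, the dimension of the degree $d$ part of the ring $\mathcal{M}_{m,n}$ of $n$ generic $m\times m$ matrices. In other words, $$\sum_{d\in\mathbb{N}}\dim\langle \mathrm{hMPS}(m,n,d)\rangle\, t^d = H(\mathcal{M}_{m,n};t,\ldots,t).$$
   Context: We work over $\mathbb{C}$, and $\mathbb{N}$ includes $0$. Homogeneous matrix product states: let $e_1,\ldots,e_n$ be the standard basis of $\mathbb{C}^n$. The variety $\mathrm{hMPS}(m,n,d)\subseteq(\mathbb{C}^n)^{\otimes d}$ is the closure of the image of the map $$(\mathbb{C}^{m\times m})^{n+1}\to(\mathbb{C}^n)^{\otimes d},\qquad (X,A_1,\ldots,A_n)\mapsto\sum_{1\le i_1,\ldots,i_d\le n}\operatorname{Tr}(XA_{i_1}\cdots A_{i_d})\,e_{i_1}\otimes\cdots\otimes e_{i_d}.$$ (For $d=0$ the tensor space is $\mathbb{C}$ and the empty product is the identity matrix.) The notation $\langle\cdot\rangle$ denotes linear span. Ring of generic matrices: let $\mathbb{C}\langle x_1,\ldots,x_n\rangle$ be the noncommutative polynomial ring (free associative unital algebra) in $n$ variables. An element $f$ is a polynomial identity for $m\times m$ matrices if it vanishes when $x_1,\ldots,x_n$ are substituted by generic $m\times m$ matrices $X_1,\ldots,X_n$ (i.e. matrices whose $nm^2$ entries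 are independent commuting variables). The ring $\mathcal{M}_{m,n}$ is the quotient of $\mathbb{C}\langle x_1,\ldots,x_n\rangle$ by the ideal of polynomial identities for $m\times m$ matrices. It inherits the $\mathbb{N}^n$-grading in which $x_i$ has degree the $i$-th standard basis vector; $\mathcal{M}_{m,n;d}$ denotes the part of total degree $d$. Hilbert series: for an $\mathbb{N}^n$-graded vector space $R$, $H(R;t_1,\ldots,t_n)=\sum_{(d_1,\ldots,d_n)\in\mathbb{N}^n}\dim R_{(d_1,\ldots,d_n)}\,t_1^{d_1}\cdots t_n^{d_n}$. *)

theory Defs
  imports
    "HOL-Analysis.Analysis"
    "HOL-Library.Poly_Mapping"
    "HOL-Library.Function_Algebras"
    "HOL-Computational_Algebra.Formal_Power_Series"
begin

text \<open>
  The sizes \<open>m\<close> and \<open>n\<close> are the cardinalities of the finite (hence nonempty) index types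
  \<open>'m\<close> and \<open>'n\<close>; the tensor order \<open>d\<close> is a natural number.
\<close>

section \<open>Matrix words and commutative polynomials\<close>

definition mat_word :: "('n \<Rightarrow> 'a::semiring_1^'m^'m) \<Rightarrow> 'n list \<Rightarrow> 'a^'m^'m" where
  "mat_word A w = foldr (\<lambda>i M. A i ** M) w (mat 1)"

text \<open>
  Commutative polynomials with complex coefficients in the variables \<open>'v\<close>: finitely
  supported functions on monomials, a monomial being a finitely supported exponent vector.
\<close>

type_synonym 'v mpoly = "('v \<Rightarrow>\<^sub>0 nat) \<Rightarrow>\<^sub>0 complex"

definition mpoly_const :: "complex \<Rightarrow> 'v mpoly" where
  "mpoly_const c = Poly_Mapping.single 0 c"

definition mpoly_var :: "'v \<Rightarrow> 'v mpoly" where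
  "mpoly_var v = Poly_Mapping.single (Poly_Mapping.single v 1) 1"

definition mpoly_eval :: "'v mpoly \<Rightarrow> ('v \<Rightarrow> complex) \<Rightarrow> complex" where
  "mpoly_eval p x =
    (\<Sum>a\<in>Poly_Mapping.keys p.
      Poly_Mapping.lookup p a * (\<Prod>v\<in>Poly_Mapping.keys a. x v ^ Poly_Mapping.lookup a v))"


section \<open>Homogeneous matrix product states\<close>

text \<open>
  A tensor is given by its coordinates: \<open>T [i\<^sub>1, \<dots>, i\<^sub>d]\<close> is the coefficient of
  \<open>e\<^sub>i\<^sub>1 \<otimes> \<dots> \<otimes> e\<^sub>i\<^sub>d\<close>. The tensors of order \<open>d\<close> are the functions supported on
  words of length \<open>d\<close>; vector space operations on functions are pointwise.
\<close>

type_synonym 'n tensor = "'n list \<Rightarrow> complex"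

definition tensor_space :: "nat \<Rightarrow> 'n tensor set" where
  "tensor_space d = {T. \<forall>w. length w \<noteq> d \<longrightarrow> T w = 0}"

definition tensor_scale :: "complex \<Rightarrow> 'n tensor \<Rightarrow> 'n tensor" where
  "tensor_scale c T = (\<lambda>w. c * T w)"

global_interpretation tensor: vector_space tensor_scale
  by standard (auto simp: tensor_scale_def fun_eq_iff algebra_simps)

definition pure_tensor :: "(complex^'n) list \<Rightarrow> 'n::finite tensor" where
  "pure_tensor vs = (\<lambda>w. if length w = length vs then \<Prod>k<length vs. (vs ! k) $ (w ! k) else 0)"

definition hMPS_map ::
    "nat \<Rightarrow> complex^'m^'m \<Rightarrow> ('n \<Rightarrow> complex^'m^'m) \<Rightarrow> 'n::finite tensor" where
  "hMPS_map d X A =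
    (\<Sum>w | length w = d.
      tensor_scale (trace (X ** mat_word A w)) (pure_tensor (map (\<lambda>i. axis i 1) w)))"

text \<open>
  The Zariski closure in \<open>tensor_space d\<close>. Polynomials may mention coordinates of words of
  length other than \<open>d\<close>; these vanish identically on \<open>tensor_space d\<close>.
\<close>

definition zariski_closure :: "nat \<Rightarrow> 'n tensor set \<Rightarrow> 'n tensor set" where
  "zariski_closure d S =
    {T \<in> tensor_space d.
      \<forall>p :: 'n list mpoly. (\<forall>U\<in>S. mpoly_eval p U = 0) \<longrightarrow> mpoly_eval p T = 0}"

definition hMPS :: "'m::finite itself \<Rightarrow> nat \<Rightarrow> 'n::finite tensor set" where
  "hMPS _ d =
    zariski_closure d {hMPS_map d X A | (X :: complex^'m^'m) (A :: 'n \<Rightarrow> complex^'m^'m). True}"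


section \<open>The free algebra\<close>

datatype 'n free_monoid = Word (letters: "'n list")

instantiation free_monoid :: (type) monoid_add
begin

definition zero_free_monoid :: "'a free_monoid" where
  "0 = Word []"

definition plus_free_monoid :: "'a free_monoid \<Rightarrow> 'a free_monoid \<Rightarrow> 'a free_monoid" where
  "v + w = Word (letters v @ letters w)"

instance
  by standard (auto simp: zero_free_monoid_def plus_free_monoid_def)

end

text \<open>
  The noncommutative polynomial ring over the complex numbers, as a monoid algebra; the library's
  convolution product on finitely supported functions makes it an instance of \<open>ring_1\<close>.
\<close>

type_synonym 'n free_algebra = "'n free_monoid \<Rightarrow>\<^sub>0 complex"

definition free_scale :: "complex \<Rightarrow> 'n free_algebra \<Rightarrow> 'n free_algebra" where
  "free_scale c f = Poly_Mapping.single 0 c * f"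

definition free_part :: "('n \<Rightarrow> nat) \<Rightarrow> 'n free_algebra set" where
  "free_part a = {f. \<forall>w\<in>Poly_Mapping.keys f. \<forall>i. count_list (letters w) i = a i}"


section \<open>Polynomial identities and the ring of generic matrices\<close>

definition generic_matrix :: "'n \<Rightarrow> ('n \<times> 'm \<times> 'm) mpoly^'m^'m" where
  "generic_matrix i = (\<chi> j k. mpoly_var (i, j, k))"

definition generic_eval :: "'n free_algebra \<Rightarrow> ('n \<times> 'm \<times> 'm) mpoly^'m^'m" where
  "generic_eval f =
    (\<Sum>w\<in>Poly_Mapping.keys f.
      mat (mpoly_const (Poly_Mapping.lookup f w)) ** mat_word generic_matrix (letters w))"

definition polynomial_identities :: "'m::finite itself \<Rightarrow> 'n free_algebra set" where
  "polynomial_identities _ = {f. generic_eval f = (0 :: ('n \<times> 'm \<times> 'm) mpoly^'m^'m)}"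

lemma mpoly_const_add: "mpoly_const (a + b) = mpoly_const a + mpoly_const b"
  by (simp add: mpoly_const_def single_add)

lemma mpoly_const_mult: "mpoly_const (a * b) = mpoly_const a * mpoly_const b"
  by (simp add: mpoly_const_def mult_single)

lemma mpoly_const_0 [simp]: "mpoly_const 0 = 0"
  by (simp add: mpoly_const_def)

lemma mat_mult_entry: "(mat c ** M) $ j $ k = c * M $ j $ k"
  for M :: "'a::comm_ring_1^'m^'m"
  by (simp add: matrix_matrix_mult_def mat_def if_distrib[of "\<lambda>x. x * _"] cong: if_cong)

lemma mat_word_append: "mat_word A (v @ w) = mat_word A v ** mat_word A w"
  for A :: "'n \<Rightarrow> 'a::comm_ring_1^'m^'m"
  by (induction v) (simp_all add: mat_word_def matrix_mul_assoc)

lemma generic_eval_entry: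
  assumes "finite S" "Poly_Mapping.keys f \<subseteq> S"
  shows "generic_eval f $ j $ k =
    (\<Sum>w\<in>S. mpoly_const (Poly_Mapping.lookup f w) * mat_word generic_matrix (letters w) $ j $ k)"
proof -
  have "generic_eval f $ j $ k = (\<Sum>w\<in>Poly_Mapping.keys f.
      mpoly_const (Poly_Mapping.lookup f w) * mat_word generic_matrix (letters w) $ j $ k)"
    by (simp add: generic_eval_def mat_mult_entry)
  also have "\<dots> = (\<Sum>w\<in>S.
      mpoly_const (Poly_Mapping.lookup f w) * mat_word generic_matrix (letters w) $ j $ k)"
    using assms by (intro sum.mono_neutral_left) (auto simp: in_keys_iff)
  finally show ?thesis .
qed

lemma generic_eval_add: "generic_eval (f + g) = generic_eval f + generic_eval g"
proof -
  let ?S = "Poly_Mapping.keys f \<union> Poly_Mapping.keys g"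
  have "Poly_Mapping.keys (f + g) \<subseteq> ?S"
    by (rule Poly_Mapping.keys_add)
  then show ?thesis
    by (simp add: vec_eq_iff generic_eval_entry[of ?S] lookup_add mpoly_const_add
        algebra_simps sum.distrib)
qed

lemma generic_eval_0 [simp]: "generic_eval 0 = 0"
  by (simp add: generic_eval_def)

lemma generic_eval_minus: "generic_eval (- f) = - generic_eval f"
  using generic_eval_add[of f "- f"] by (simp add: eq_neg_iff_add_eq_0 add.commute)

lemma generic_eval_diff: "generic_eval (f - g) = generic_eval f - generic_eval g"
  using generic_eval_add[of f "- g"] by (simp add: generic_eval_minus)

lemma generic_eval_sum: "generic_eval (\<Sum>x\<in>S. F x) = (\<Sum>x\<in>S. generic_eval (F x))"
  by (induction S rule: infinite_finite_induct) (simp_all add: generic_eval_add)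

lemma generic_eval_single:
  "generic_eval (Poly_Mapping.single w c) = mat (mpoly_const c) ** mat_word generic_matrix (letters w)"
  by (simp add: vec_eq_iff generic_eval_entry[of "{w}"] mat_mult_entry)

lemma poly_mapping_sum_single:
  "f = (\<Sum>w\<in>Poly_Mapping.keys f. Poly_Mapping.single w (Poly_Mapping.lookup f w))"
  by (rule poly_mapping_eqI) (simp add: lookup_sum lookup_single when_def in_keys_iff)

lemma matrix_mul_sum_left: "(\<Sum>x\<in>S. F x) ** M = (\<Sum>x\<in>S. F x ** M)"
  for M :: "'a::comm_ring_1^'m^'m"
  by (simp add: vec_eq_iff matrix_matrix_mult_def sum_distrib_right sum.swap[of _ S])

lemma matrix_mul_sum_right: "M ** (\<Sum>x\<in>S. F x) = (\<Sum>x\<in>S. M ** F x)"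
  for M :: "'a::comm_ring_1^'m^'m"
  by (simp add: vec_eq_iff matrix_matrix_mult_def sum_distrib_left sum.swap[of _ S])

lemma generic_eval_mult: "generic_eval (f * g) = generic_eval f ** generic_eval g"
proof -
  have single: "generic_eval (Poly_Mapping.single v a * Poly_Mapping.single w b) =
      generic_eval (Poly_Mapping.single v a) ** generic_eval (Poly_Mapping.single w b)" for v w a b
    by (simp add: vec_eq_iff mult_single generic_eval_single plus_free_monoid_def mpoly_const_mult
        mat_word_append mat_mult_entry)
      (simp add: matrix_matrix_mult_def[of "mat (mpoly_const a) ** _"] mat_mult_entry
        matrix_matrix_mult_def[of "mat_word _ _"] sum_distrib_left algebra_simps)
  let ?s = "\<lambda>f w. Poly_Mapping.single w (Poly_Mapping.lookup f w)"
  have "f * g = (\<Sum>v\<in>Poly_Mapping.keys f. ?s f v) * (\<Sum>w\<in>Poly_Mapping.keys g. ?s g w)"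
    using poly_mapping_sum_single[of f] poly_mapping_sum_single[of g] by simp
  also have "\<dots> = (\<Sum>v\<in>Poly_Mapping.keys f. \<Sum>w\<in>Poly_Mapping.keys g. ?s f v * ?s g w)"
    by (simp add: sum_product)
  finally have "generic_eval (f * g) =
      (\<Sum>v\<in>Poly_Mapping.keys f. generic_eval (?s f v)) **
      (\<Sum>w\<in>Poly_Mapping.keys g. generic_eval (?s g w))"
    by (simp add: generic_eval_sum single matrix_mul_sum_left matrix_mul_sum_right
        sum.swap[of _ "Poly_Mapping.keys g"])
  also have "\<dots> = generic_eval f ** generic_eval g"
    using poly_mapping_sum_single[of f] poly_mapping_sum_single[of g]
    by (simp flip: generic_eval_sum)
  finally show ?thesis .
qed

lemma generic_eval_1 [simp]: "generic_eval 1 = mat 1"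
proof -
  have "generic_eval (Poly_Mapping.single 0 1) = mat 1"
    by (simp add: generic_eval_single vec_eq_iff mat_mult_entry mpoly_const_def
        zero_free_monoid_def mat_word_def)
  then show ?thesis
    by simp
qed

lemma pi_diff_iff:
  "f - g \<in> polynomial_identities TYPE('m::finite) \<longleftrightarrow>
    generic_eval f = (generic_eval g :: ('n \<times> 'm \<times> 'm) mpoly^'m^'m)"
  by (simp add: polynomial_identities_def generic_eval_diff)

quotient_type ('m, 'n) generic_matrix_ring =
  "'n free_algebra" / "\<lambda>f g. f - g \<in> polynomial_identities TYPE('m::finite)"
  by (rule equivpI) (auto simp: pi_diff_iff reflp_def symp_def transp_def)

instantiation generic_matrix_ring :: (finite, type) ring_1
begin

lift_definition zero_generic_matrix_ring :: "('a, 'b) generic_matrix_ring" is 0 .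

lift_definition one_generic_matrix_ring :: "('a, 'b) generic_matrix_ring" is 1 .

lift_definition plus_generic_matrix_ring ::
    "('a, 'b) generic_matrix_ring \<Rightarrow> ('a, 'b) generic_matrix_ring \<Rightarrow> ('a, 'b) generic_matrix_ring"
  is "(+)"
  by (simp add: pi_diff_iff generic_eval_add)

lift_definition uminus_generic_matrix_ring ::
    "('a, 'b) generic_matrix_ring \<Rightarrow> ('a, 'b) generic_matrix_ring"
  is uminus
  by (simp add: pi_diff_iff generic_eval_minus)

lift_definition minus_generic_matrix_ring ::
    "('a, 'b) generic_matrix_ring \<Rightarrow> ('a, 'b) generic_matrix_ring \<Rightarrow> ('a, 'b) generic_matrix_ring"
  is "(-)"
  by (simp add: pi_diff_iff generic_eval_diff)

lift_definition times_generic_matrix_ring ::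
    "('a, 'b) generic_matrix_ring \<Rightarrow> ('a, 'b) generic_matrix_ring \<Rightarrow> ('a, 'b) generic_matrix_ring"
  is "(*)"
  by (simp add: pi_diff_iff generic_eval_mult)

lemmas gm_abs_eq =
  zero_generic_matrix_ring.abs_eq one_generic_matrix_ring.abs_eq plus_generic_matrix_ring.abs_eq
  uminus_generic_matrix_ring.abs_eq minus_generic_matrix_ring.abs_eq
  times_generic_matrix_ring.abs_eq

instance
proof
  fix a b c :: "('a, 'b) generic_matrix_ring"
  show "a + b + c = a + (b + c)"
    by (induct a rule: generic_matrix_ring.abs_induct,
        induct b rule: generic_matrix_ring.abs_induct,
        induct c rule: generic_matrix_ring.abs_induct)
      (simp add: gm_abs_eq add.assoc)
  show "a + b = b + a"
    by (induct a rule: generic_matrix_ring.abs_induct,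
        induct b rule: generic_matrix_ring.abs_induct)
      (simp add: gm_abs_eq add.commute)
  show "0 + a = a"
    by (induct a rule: generic_matrix_ring.abs_induct)
      (simp add: gm_abs_eq)
  show "- a + a = 0"
    by (induct a rule: generic_matrix_ring.abs_induct)
      (simp add: gm_abs_eq)
  show "a - b = a + - b"
    by (induct a rule: generic_matrix_ring.abs_induct,
        induct b rule: generic_matrix_ring.abs_induct)
      (simp add: gm_abs_eq)
  show "a * b * c = a * (b * c)"
    by (induct a rule: generic_matrix_ring.abs_induct,
        induct b rule: generic_matrix_ring.abs_induct,
        induct c rule: generic_matrix_ring.abs_induct)
      (simp add: gm_abs_eq mult.assoc)
  show "(a + b) * c = a * c + b * c"
    by (induct a rule: generic_matrix_ring.abs_induct,
        induct b rule: generic_matrix_ring.abs_induct,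
        induct c rule: generic_matrix_ring.abs_induct)
      (simp add: gm_abs_eq distrib_right)
  show "a * (b + c) = a * b + a * c"
    by (induct a rule: generic_matrix_ring.abs_induct,
        induct b rule: generic_matrix_ring.abs_induct,
        induct c rule: generic_matrix_ring.abs_induct)
      (simp add: gm_abs_eq distrib_left)
  show "1 * a = a"
    by (induct a rule: generic_matrix_ring.abs_induct)
      (simp add: gm_abs_eq)
  show "a * 1 = a"
    by (induct a rule: generic_matrix_ring.abs_induct)
      (simp add: gm_abs_eq)
  have "mat 1 \<noteq> (0 :: ('b \<times> 'a \<times> 'a) mpoly^'a^'a)"
    by (simp add: vec_eq_iff mat_def)
  then show "(0 :: ('a, 'b) generic_matrix_ring) \<noteq> 1"
    by (simp add: gm_abs_eq generic_matrix_ring.abs_eq_iff polynomial_identities_def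
        generic_eval_minus)
qed

end

lift_definition gm_scale ::
    "complex \<Rightarrow> ('m::finite, 'n) generic_matrix_ring \<Rightarrow> ('m, 'n) generic_matrix_ring"
  is free_scale
  by (simp add: pi_diff_iff free_scale_def generic_eval_mult)

lemma free_scale_simps:
  "free_scale c (f + g) = free_scale c f + free_scale c g"
  "free_scale (c + c') f = free_scale c f + free_scale c' f"
  "free_scale c (free_scale c' f) = free_scale (c * c') f"
  "free_scale 1 f = f"
  by (simp_all add: free_scale_def algebra_simps single_add mult_single flip: mult.assoc)

global_interpretation gm: vector_space gm_scale
proof
  fix a b :: complex and x y :: "('m::finite, 'n) generic_matrix_ring"
  show "gm_scale a (x + y) = gm_scale a x + gm_scale a y"
    by (induct x rule: generic_matrix_ring.abs_induct,
        induct y rule: generic_matrix_ring.abs_induct)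
      (simp add: gm_scale.abs_eq plus_generic_matrix_ring.abs_eq free_scale_simps)
  show "gm_scale (a + b) x = gm_scale a x + gm_scale b x"
    by (induct x rule: generic_matrix_ring.abs_induct)
      (simp add: gm_scale.abs_eq plus_generic_matrix_ring.abs_eq free_scale_simps)
  show "gm_scale a (gm_scale b x) = gm_scale (a * b) x"
    by (induct x rule: generic_matrix_ring.abs_induct)
      (simp add: gm_scale.abs_eq free_scale_simps)
  show "gm_scale 1 x = x"
    by (induct x rule: generic_matrix_ring.abs_induct)
      (simp add: gm_scale.abs_eq free_scale_simps)
qed

definition gm_part :: "('n \<Rightarrow> nat) \<Rightarrow> ('m::finite, 'n) generic_matrix_ring set" where
  "gm_part a = abs_generic_matrix_ring ` free_part a"

definition gm_degree_part :: "nat \<Rightarrow> ('m::finite, 'n::finite) generic_matrix_ring set" where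
  "gm_degree_part d = gm.span (\<Union>a\<in>{a. (\<Sum>i\<in>UNIV. a i) = d}. gm_part a)"


section \<open>Hilbert series\<close>

text \<open>
  The Hilbert series of the graded vector space with graded parts \<open>R a\<close>, with power series
  \<open>s i\<close> in one variable substituted for its variables. The infinite sum is taken in the
  library's topology on formal power series (the adic one); it converges whenever every
  \<open>s i\<close> has vanishing constant term.
\<close>

definition hilbert_series ::
    "(complex \<Rightarrow> 'v \<Rightarrow> 'v) \<Rightarrow> (('n::finite \<Rightarrow> nat) \<Rightarrow> 'v::ab_group_add set) \<Rightarrow>
      ('n \<Rightarrow> int fps) \<Rightarrow> int fps" where
  "hilbert_series scal R s =
    (\<Sum>\<^sub>\<infinity>a\<in>UNIV. of_nat (vector_space.dim scal (R a)) * (\<Prod>i\<in>UNIV. s i ^ a i))"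

end

theory Submission
  imports Defs
begin

text \<open>
  Pairing a free algebra element with the tensor of \<open>(X, A)\<close> gives the trace of \<open>X f(A)\<close>, so the
  degree \<open>d\<close> polynomial identities are exactly the linear relations between the coordinates of the
  matrix product states. Hence words whose classes form a basis of the degree \<open>d\<close> part of the
  generic matrix ring are coordinates on the span. Choosing such words within each
  multidegree, which is possible since rescaling \<open>A i\<close> by \<open>t i\<close> separates the multidegrees of an
  identity, also gives the Hilbert series.
\<close>

section \<open>Linear algebra\<close>

context vector_space
begin

text \<open>Independence of the indexed family makes \<open>e\<close> injective on \<open>B\<close>:
  two equal members would give a relation with coefficients 1 and -1. The image is then a basis with
  as many elements as \<open>B\<close>. Families are indexed because distinct words may have the
  same class in the quotient ring.\<close>

lemma dim_eq_card_family:
  assumes fin: "finite B" and sub: "e ` B \<subseteq> V" and span: "V \<subseteq> span (e ` B)"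
    and indep: "\<And>c. (\<Sum>b\<in>B. scale (c b) (e b)) = 0 \<Longrightarrow> \<forall>b\<in>B. c b = 0"
  shows "dim V = card B"
proof -
  have inj: "inj_on e B"
  proof (rule inj_onI, rule ccontr)
    fix x y assume xy: "x \<in> B" "y \<in> B" "e x = e y" "x \<noteq> y"
    let ?c = "\<lambda>b. if b = x then 1 else if b = y then -1 else 0"
    have "(\<Sum>b\<in>B. scale (?c b) (e b)) = (\<Sum>b\<in>{x, y}. scale (?c b) (e b))"
      using fin xy by (intro sum.mono_neutral_right) auto
    also have "\<dots> = 0"
      using xy by simp
    finally show False
      using indep[of ?c] xy by force
  qed
  have "independent (e ` B)"
  proof (rule independent_if_scalars_zero)
    fix f x assume "(\<Sum>x\<in>e ` B. scale (f x) x) = 0" "x \<in> e ` B"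
    then show "f x = 0"
      using indep[of "f \<circ> e"] by (auto simp: sum.reindex[OF inj])
  qed (use fin in simp)
  then show ?thesis
    using dim_unique[OF sub span] card_image[OF inj] by blast
qed

text \<open>A maximal independent subset of the image is lifted to \<open>K\<close> by choosing one
  index for each of its vectors.\<close>

lemma basis_family:
  assumes fin: "finite K"
  shows "\<exists>B\<subseteq>K. e ` K \<subseteq> span (e ` B) \<and>
    (\<forall>c. (\<Sum>b\<in>B. scale (c b) (e b)) = 0 \<longrightarrow> (\<forall>b\<in>B. c b = 0))"
proof -
  obtain C where C: "C \<subseteq> e ` K" "independent C" "e ` K \<subseteq> span C"
    using maximal_independent_subset[of "e ` K"] .
  from C(1)[unfolded subset_image_inj] obtain B where B: "B \<subseteq> K" "inj_on e B" "C = e ` B"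
    by blast
  have finC: "finite (e ` B)"
    using B(1) fin finite_subset by blast
  have "\<forall>b\<in>B. c b = 0" if "(\<Sum>b\<in>B. scale (c b) (e b)) = 0" for c
  proof -
    \<comment> \<open>Since \<open>e\<close> is injective on \<open>B\<close>, coefficients on
      indices become coefficients on vectors.\<close>
    let ?u = "\<lambda>v. c (inv_into B e v)"
    have "(\<Sum>v\<in>e ` B. scale (?u v) v) = 0"
      using that by (simp add: sum.reindex[OF B(2)] B(2))
    moreover have "\<not> (\<exists>u. (\<exists>v\<in>e ` B. u v \<noteq> 0) \<and> (\<Sum>v\<in>e ` B. scale (u v) v) = 0)"
      using C(2) B(3) dependent_finite[OF finC] by simp
    then have "(\<Sum>v\<in>e ` B. scale (?u v) v) = 0 \<longrightarrow> (\<forall>v\<in>e ` B. ?u v = 0)"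
      by (rule contrapos_np) (intro exI[of _ ?u], blast)
    ultimately have "\<forall>v\<in>e ` B. ?u v = 0"
      by (rule rev_mp)
    then show ?thesis
      using B(2) by simp
  qed
  with B C(3) show ?thesis
    by (intro exI[of _ B]) simp_all
qed

text \<open>The combinations with coefficients indexed by \<open>B\<close> form a subspace
  containing the family, and so contain its span.\<close>

lemma span_imageE:
  assumes "v \<in> span (e ` B)" "finite B"
  obtains c where "v = (\<Sum>b\<in>B. scale (c b) (e b))"
proof -
  let ?R = "range (\<lambda>c. \<Sum>b\<in>B. scale (c b) (e b))"
  have "subspace ?R"
  proof (rule subspaceI)
    show "0 \<in> ?R"
      by (rule image_eqI[of _ _ "\<lambda>_. 0"]) simp_all
    show "x + y \<in> ?R" if xy: "x \<in> ?R" "y \<in> ?R" for x y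
    proof -
      from xy obtain c c' where "x = (\<Sum>b\<in>B. scale (c b) (e b))" "y = (\<Sum>b\<in>B. scale (c' b) (e b))"
        by blast
      then have "x + y = (\<Sum>b\<in>B. scale (c b + c' b) (e b))"
        by (simp add: scale_left_distrib sum.distrib)
      then show ?thesis
        by (rule range_eqI[of _ _ "\<lambda>b. c b + c' b"])
    qed
    show "scale a x \<in> ?R" if x: "x \<in> ?R" for a x
    proof -
      from x obtain c where "x = (\<Sum>b\<in>B. scale (c b) (e b))" by blast
      then have "scale a x = (\<Sum>b\<in>B. scale (a * c b) (e b))"
        by (simp add: scale_sum_right)
      then show ?thesis
        by (rule range_eqI[of _ _ "\<lambda>b. a * c b"])
    qed
  qed
  moreover have "e ` B \<subseteq> ?R"
  proof
    fix v assume "v \<in> e ` B"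
    then obtain b where b: "b \<in> B" "v = e b" by blast
    have "(\<Sum>b'\<in>B. scale (if b' = b then 1 else 0) (e b')) = (\<Sum>b'\<in>{b}. scale 1 (e b'))"
      using assms(2) b by (intro sum.mono_neutral_cong_right) auto
    then show "v \<in> ?R"
      using b by (intro image_eqI[of _ _ "\<lambda>b'. if b' = b then 1 else 0"]) simp_all
  qed
  ultimately have "span (e ` B) \<subseteq> ?R"
    by (rule span_minimal[rotated])
  then show ?thesis
    using assms(1) that by blast
qed

end

section \<open>Dimension of a span of tensors from independent coordinates\<close>

lemma sum_fun_apply: "(\<Sum>x\<in>S. F x) w = (\<Sum>x\<in>S. F x w)"
  by (induction S rule: infinite_finite_induct) simp_all

text \<open>Gaussian elimination by induction on \<open>B\<close>: the coordinates already treated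
  are cleared from a tensor of \<open>S\<close>, the remainder is normalised at the new word, and
  the old dual vectors are corrected by it.\<close>

lemma tensor_dual_family:
  fixes S :: "'n tensor set"
  assumes "finite B"
    and "\<And>c. (\<And>T. T \<in> S \<Longrightarrow> (\<Sum>b\<in>B. c b * T b) = 0) \<Longrightarrow> \<forall>b\<in>B. c b = 0"
  shows "\<exists>E. \<forall>b\<in>B. E b \<in> tensor.span S \<and> (\<forall>b'\<in>B. E b b' = (if b = b' then 1 else 0))"
  using assms
proof (induction B)
  case empty
  then show ?case by simp
next
  case (insert b0 B)
  \<comment> \<open>A relation on \<open>B\<close> extends by 0 at \<open>b0\<close>, so
    independence passes to the smaller set.\<close>
  have "\<forall>b\<in>B. c b = 0" if c: "\<And>T. T \<in> S \<Longrightarrow> (\<Sum>b\<in>B. c b * T b) = 0" for c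
  proof -
    have "(\<Sum>b\<in>insert b0 B. (c(b0 := 0)) b * T b) = (\<Sum>b\<in>B. c b * T b)" for T
      using insert.hyps by (intro sum.mono_neutral_cong_right) auto
    then have "\<forall>b\<in>insert b0 B. (c(b0 := 0)) b = 0"
      using c by (intro insert.prems) simp
    then show ?thesis
      using insert.hyps by (metis fun_upd_other insertCI)
  qed
  from insert.IH[OF this] obtain E where
    E: "\<And>b. b \<in> B \<Longrightarrow> E b \<in> tensor.span S"
       "\<And>b b'. b \<in> B \<Longrightarrow> b' \<in> B \<Longrightarrow> E b b' = (if b = b' then 1 else 0)"
    by blast
  \<comment> \<open>\<open>P T\<close> is the remainder of \<open>T\<close> after elimination; its
    coordinates in \<open>B\<close> vanish.\<close>
  define P where "P T = T - (\<Sum>b\<in>B. tensor_scale (T b) (E b))" for T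
  have P_span: "P T \<in> tensor.span S" if "T \<in> S" for T
    unfolding P_def using E(1) tensor.span_base[OF that]
    by (intro tensor.span_diff tensor.span_sum tensor.span_scale)
  have P_apply: "P T w = T w - (\<Sum>b\<in>B. T b * E b w)" for T w
    by (simp add: P_def sum_fun_apply tensor_scale_def)
  have P_B: "P T b = 0" if "b \<in> B" for T b
  proof -
    have "(\<Sum>b'\<in>B. T b' * E b' b) = (\<Sum>b'\<in>B. if b' = b then T b' else 0)"
      using E(2) that by (intro sum.cong) auto
    then show ?thesis
      using that insert.hyps by (simp add: P_apply)
  qed
  have "\<exists>T\<in>S. P T b0 \<noteq> 0"
  proof (rule ccontr)
    assume "\<not> ?thesis"
    \<comment> \<open>If every remainder vanished at \<open>b0\<close>, the formula for
      \<open>P T b0\<close> would be a relation on \<open>S\<close> with coefficient 1 at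
      \<open>b0\<close>.\<close>
    moreover have "(\<Sum>b\<in>insert b0 B. (if b = b0 then 1 else - E b b0) * T b) = P T b0" for T
    proof -
      have "(\<Sum>b\<in>B. (if b = b0 then 1 else - E b b0) * T b) = (\<Sum>b\<in>B. - (T b * E b b0))"
        using insert.hyps by (intro sum.cong) auto
      then show ?thesis
        using insert.hyps by (simp add: P_apply sum_negf)
    qed
    ultimately have "\<forall>b\<in>insert b0 B. (if b = b0 then 1 else - E b b0) = 0"
      by (intro insert.prems) simp
    then show False
      by simp
  qed
  then obtain T where T: "T \<in> S" "P T b0 \<noteq> 0" by blast
  define F where "F = tensor_scale (1 / P T b0) (P T)"
  have F_span: "F \<in> tensor.span S"
    unfolding F_def using P_span[OF T(1)] by (rule tensor.span_scale)
  have F: "F b0 = 1" "\<And>b. b \<in> B \<Longrightarrow> F b = 0"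
    using T P_B by (auto simp: F_def tensor_scale_def)
  define E' where "E' b = (if b = b0 then F else E b - tensor_scale (E b b0) F)" for b
  have "E' b \<in> tensor.span S" if "b \<in> insert b0 B" for b
    using that F_span E(1) by (auto simp: E'_def intro!: tensor.span_diff tensor.span_scale)
  moreover have "E' b b' = (if b = b' then 1 else 0)" if "b \<in> insert b0 B" "b' \<in> insert b0 B" for b b'
    using that F E(2) insert.hyps by (auto simp: E'_def tensor_scale_def)
  ultimately show ?case
    by (intro exI[of _ E'] ballI conjI)
qed

text \<open>On the span of \<open>S\<close> the coordinates in \<open>B\<close> form a basis of the
  dual space: \<open>free\<close> gives independence, \<open>determined\<close> gives generation.
  The dual family is therefore a basis of the span.\<close>

lemma tensor_dim_span:
  fixes S :: "'n tensor set"
  assumes fin: "finite B"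
    and free: "\<And>c. (\<And>T. T \<in> S \<Longrightarrow> (\<Sum>b\<in>B. c b * T b) = 0) \<Longrightarrow> \<forall>b\<in>B. c b = 0"
    and determined: "\<And>w. \<exists>c. \<forall>T\<in>S. T w = (\<Sum>b\<in>B. c b * T b)"
  shows "tensor.dim (tensor.span S) = card B"
proof -
  have "\<exists>E. \<forall>b\<in>B. E b \<in> tensor.span S \<and> (\<forall>b'\<in>B. E b b' = (if b = b' then 1 else 0))"
    using fin free by (rule tensor_dual_family)
  then obtain E where E: "\<And>b. b \<in> B \<Longrightarrow> E b \<in> tensor.span S"
    "\<And>b b'. b \<in> B \<Longrightarrow> b' \<in> B \<Longrightarrow> E b b' = (if b = b' then 1 else 0)"
    by blast
  have coord: "(\<Sum>b\<in>B. tensor_scale (c b) (E b)) b' = c b'" if "b' \<in> B" for c b'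
  proof -
    have "(\<Sum>b\<in>B. c b * E b b') = (\<Sum>b\<in>B. if b = b' then c b else 0)"
      using E(2) that by (intro sum.cong) auto
    then show ?thesis
      using that fin by (simp add: sum_fun_apply tensor_scale_def)
  qed
  \<comment> \<open>The tensors satisfying one linear expression for a coordinate form a subspace,
    so the expression extends from \<open>S\<close> to its span.\<close>
  have det_span: "T w = (\<Sum>b\<in>B. c b * T b)"
    if "T \<in> tensor.span S" and c: "\<And>T. T \<in> S \<Longrightarrow> T w = (\<Sum>b\<in>B. c b * T b)" for T w c
  proof -
    have "tensor.subspace {T. T w = (\<Sum>b\<in>B. c b * T b)}"
      by (rule tensor.subspaceI)
        (simp_all add: tensor_scale_def sum.distrib distrib_left sum_distrib_left mult_ac)
    then have "tensor.span S \<subseteq> {T. T w = (\<Sum>b\<in>B. c b * T b)}"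
      using c by (intro tensor.span_minimal) auto
    then show ?thesis
      using that(1) by blast
  qed
  show ?thesis
  proof (rule tensor.dim_eq_card_family[OF fin, where e = E])
    show "E ` B \<subseteq> tensor.span S"
      using E(1) by blast
    show "\<forall>b\<in>B. c b = 0" if "(\<Sum>b\<in>B. tensor_scale (c b) (E b)) = 0" for c
      using coord[of _ c] by (simp add: that)
    show "tensor.span S \<subseteq> tensor.span (E ` B)"
    proof
      fix T assume T: "T \<in> tensor.span S"
      \<comment> \<open>\<open>?U\<close> agrees with \<open>T\<close> at the words of
        \<open>B\<close>; as both lie in the span, the expressions for the remaining coordinates
        force equality.\<close>
      let ?U = "\<Sum>b\<in>B. tensor_scale (T b) (E b)"
      have U: "?U \<in> tensor.span S"
        using E(1) by (intro tensor.span_sum tensor.span_scale)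
      have "T w = ?U w" for w
      proof -
        obtain c where c: "\<And>T. T \<in> S \<Longrightarrow> T w = (\<Sum>b\<in>B. c b * T b)"
          using determined[of w] by blast
        have "T w = (\<Sum>b\<in>B. c b * T b)"
          by (rule det_span[OF T c])
        also have "\<dots> = (\<Sum>b\<in>B. c b * ?U b)"
          by (intro sum.cong refl) (simp only: coord)
        also have "\<dots> = ?U w"
          by (rule det_span[OF U c, symmetric])
        finally show ?thesis .
      qed
      then have "T = ?U" ..
      also have "\<dots> \<in> tensor.span (E ` B)"
        by (intro tensor.span_sum tensor.span_scale tensor.span_base) blast
      finally show "T \<in> tensor.span (E ` B)" .
    qed
  qed
qed


section \<open>Evaluation of commutative polynomials\<close>

text \<open>Dedekind's independence of characters, for a monoid. Subtracting
  \<open>\<phi> j y\<close> times the relation at \<open>x\<close> from the relation at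
  \<open>x * y\<close> removes the term of \<open>j\<close>; the shorter relation has coefficients
  \<open>c i * (\<phi> i y - \<phi> j y)\<close>, and some \<open>y\<close> separates
  \<open>\<phi> i\<close> from \<open>\<phi> j\<close>.\<close>

lemma dedekind_independence:
  fixes \<phi> :: "'i \<Rightarrow> 'x::monoid_mult \<Rightarrow> 'k::field"
  assumes "finite I" "inj_on \<phi> I"
    and mult: "\<And>i x y. \<phi> i (x * y) = \<phi> i x * \<phi> i y" and one: "\<And>i. \<phi> i 1 = 1"
    and "\<And>x. (\<Sum>i\<in>I. c i * \<phi> i x) = 0"
  shows "\<forall>i\<in>I. c i = 0"
  using assms(1,2,5)
proof (induction I arbitrary: c)
  case empty
  then show ?case by simp
next
  case (insert j I)
  have "(c i * (\<phi> i y - \<phi> j y)) = 0" if "i \<in> I" for i y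
  proof -
    have "(\<Sum>i\<in>I. c i * (\<phi> i y - \<phi> j y) * \<phi> i x) = 0" for x
    proof -
      have "(\<Sum>i\<in>I. c i * (\<phi> i y - \<phi> j y) * \<phi> i x) =
          (\<Sum>i\<in>insert j I. c i * (\<phi> i y - \<phi> j y) * \<phi> i x)"
        using insert.hyps by simp
      also have "\<dots> = (\<Sum>i\<in>insert j I. c i * \<phi> i (x * y)) - \<phi> j y * (\<Sum>i\<in>insert j I. c i * \<phi> i x)"
        unfolding sum_distrib_left sum_subtractf[symmetric] mult
        by (intro sum.cong) (auto simp: algebra_simps)
      finally show ?thesis
        by (simp only: insert.prems) simp
    qed
    then show ?thesis
      using insert.IH[of "\<lambda>i. c i * (\<phi> i y - \<phi> j y)"] insert.prems(1) that by auto
  qed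
  moreover have "\<exists>y. \<phi> i y \<noteq> \<phi> j y" if "i \<in> I" for i
    using insert.prems(1) insert.hyps that by (metis ext inj_onD insertCI)
  ultimately have "\<forall>i\<in>I. c i = 0"
    by fastforce
  \<comment> \<open>Only the term of \<open>j\<close> is left; evaluating at 1 shows that its
    coefficient vanishes.\<close>
  then show ?case
    using insert.prems(2)[of 1] insert.hyps one by simp
qed

text \<open>The monomial factor of \<open>mpoly_eval\<close>, isolated because it is a character of
  the monoid of points under pointwise multiplication.\<close>

definition monomial_eval :: "('v \<Rightarrow>\<^sub>0 nat) \<Rightarrow> ('v \<Rightarrow> complex) \<Rightarrow> complex" where
  "monomial_eval a x = (\<Prod>v\<in>Poly_Mapping.keys a. x v ^ Poly_Mapping.lookup a v)"

lemma monomial_eval_superset: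
  assumes "finite V" "Poly_Mapping.keys a \<subseteq> V"
  shows "monomial_eval a x = (\<Prod>v\<in>V. x v ^ Poly_Mapping.lookup a v)"
  unfolding monomial_eval_def using assms by (intro prod.mono_neutral_left) (auto simp: in_keys_iff)

lemma monomial_eval_add: "monomial_eval (a + b) x = monomial_eval a x * monomial_eval b x"
proof -
  let ?V = "Poly_Mapping.keys a \<union> Poly_Mapping.keys b"
  have "Poly_Mapping.keys (a + b) \<subseteq> ?V"
    by (rule Poly_Mapping.keys_add)
  then show ?thesis
    by (simp add: monomial_eval_superset[of ?V] lookup_add power_add prod.distrib)
qed

lemma complex_two_power_inject: "(2 :: complex) ^ m = 2 ^ n \<Longrightarrow> m = n"
  by (drule arg_cong[of _ _ norm]) (simp add: norm_power)

text \<open>At the point with value 2 at \<open>v\<close> and 1 elsewhere a monomial takes the value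
  2 to the power of its exponent at \<open>v\<close>, so its values determine its exponents.\<close>

lemma inj_monomial_eval: "inj monomial_eval"
proof (rule injI)
  fix a b :: "'v \<Rightarrow>\<^sub>0 nat" assume eq: "monomial_eval a = monomial_eval b"
  have *: "monomial_eval c ((\<lambda>_. 1)(v := 2)) = 2 ^ Poly_Mapping.lookup c v" for c :: "'v \<Rightarrow>\<^sub>0 nat" and v
  proof -
    let ?V = "insert v (Poly_Mapping.keys c)"
    have "monomial_eval c ((\<lambda>_. 1)(v := 2)) =
        (\<Prod>u\<in>?V. ((\<lambda>_. 1)(v := 2)) u ^ Poly_Mapping.lookup c u)"
      by (rule monomial_eval_superset) auto
    also have "\<dots> = (\<Prod>u\<in>{v}. 2 ^ Poly_Mapping.lookup c u)"
      by (rule prod.mono_neutral_cong_right) auto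
    finally show ?thesis by simp
  qed
  show "a = b"
  proof (rule poly_mapping_eqI)
    fix v
    have "(2::complex) ^ Poly_Mapping.lookup a v = 2 ^ Poly_Mapping.lookup b v"
      unfolding *[symmetric] eq ..
    then show "Poly_Mapping.lookup a v = Poly_Mapping.lookup b v"
      by (rule complex_two_power_inject)
  qed
qed

lemma mpoly_eval_superset:
  assumes "finite S" "Poly_Mapping.keys p \<subseteq> S"
  shows "mpoly_eval p x = (\<Sum>a\<in>S. Poly_Mapping.lookup p a * monomial_eval a x)"
  unfolding mpoly_eval_def monomial_eval_def[symmetric]
  using assms by (intro sum.mono_neutral_left) (auto simp: in_keys_iff)

lemma mpoly_eval_add: "mpoly_eval (p + q) x = mpoly_eval p x + mpoly_eval q x"
proof -
  let ?S = "Poly_Mapping.keys p \<union> Poly_Mapping.keys q"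
  have "Poly_Mapping.keys (p + q) \<subseteq> ?S"
    by (rule Poly_Mapping.keys_add)
  then show ?thesis
    by (simp add: mpoly_eval_superset[of ?S] lookup_add algebra_simps sum.distrib)
qed

lemma mpoly_eval_0 [simp]: "mpoly_eval 0 x = 0"
  by (simp add: mpoly_eval_def)

lemma mpoly_eval_sum: "mpoly_eval (\<Sum>i\<in>S. F i) x = (\<Sum>i\<in>S. mpoly_eval (F i) x)"
  by (induction S rule: infinite_finite_induct) (simp_all add: mpoly_eval_add)

lemma mpoly_eval_single: "mpoly_eval (Poly_Mapping.single a c) x = c * monomial_eval a x"
  by (simp add: mpoly_eval_superset[of "{a}"])

lemma mpoly_eval_const [simp]: "mpoly_eval (mpoly_const c) x = c"
  by (simp add: mpoly_const_def mpoly_eval_single monomial_eval_def)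

lemma mpoly_eval_1 [simp]: "mpoly_eval 1 x = 1"
  using mpoly_eval_const[of 1 x] by (simp add: mpoly_const_def)

lemma mpoly_eval_var [simp]: "mpoly_eval (mpoly_var v) x = x v"
  by (simp add: mpoly_var_def mpoly_eval_single monomial_eval_def)

lemma mpoly_eval_mult: "mpoly_eval (p * q) x = mpoly_eval p x * mpoly_eval q x"
proof -
  let ?s = "\<lambda>p a. Poly_Mapping.single a (Poly_Mapping.lookup p a)"
  have "p * q = (\<Sum>a\<in>Poly_Mapping.keys p. ?s p a) * (\<Sum>b\<in>Poly_Mapping.keys q. ?s q b)"
    using poly_mapping_sum_single[of p] poly_mapping_sum_single[of q] by simp
  also have "\<dots> = (\<Sum>a\<in>Poly_Mapping.keys p. \<Sum>b\<in>Poly_Mapping.keys q. ?s p a * ?s q b)"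
    by (simp add: sum_product)
  finally have "mpoly_eval (p * q) x =
      (\<Sum>a\<in>Poly_Mapping.keys p. \<Sum>b\<in>Poly_Mapping.keys q. mpoly_eval (?s p a) x * mpoly_eval (?s q b) x)"
    by (simp add: mpoly_eval_sum mult_single mpoly_eval_single monomial_eval_add mult_ac)
  also have "\<dots> = (\<Sum>a\<in>Poly_Mapping.keys p. mpoly_eval (?s p a) x) *
      (\<Sum>b\<in>Poly_Mapping.keys q. mpoly_eval (?s q b) x)"
    by (simp add: sum_product)
  also have "\<dots> = mpoly_eval p x * mpoly_eval q x"
    using poly_mapping_sum_single[of p] poly_mapping_sum_single[of q]
    by (simp flip: mpoly_eval_sum)
  finally show ?thesis .
qed

text \<open>Distinct monomials are distinct characters, so by Dedekind a polynomial that vanishes at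
  every point has zero coefficients. This turns identities of generic matrices into identities of
  complex matrices.\<close>

lemma mpoly_eq_0_iff: "p = 0 \<longleftrightarrow> (\<forall>x. mpoly_eval p x = 0)"
proof
  assume *: "\<forall>x. mpoly_eval p x = 0"
  have "\<forall>a\<in>Poly_Mapping.keys p. Poly_Mapping.lookup p a = 0"
  proof (rule dedekind_independence[where \<phi> = monomial_eval])
    show "inj_on monomial_eval (Poly_Mapping.keys p)"
      using inj_monomial_eval by (rule inj_on_subset) simp
  qed (use * in \<open>auto simp: mpoly_eval_superset[OF finite_keys order_refl] monomial_eval_def
          power_mult_distrib prod.distrib\<close>)
  then show "p = 0"
    by (simp add: in_keys_iff poly_mapping_eqI)
qed simp


section \<open>Relations between words\<close>

definition gm_word :: "'n list \<Rightarrow> ('m::finite, 'n) generic_matrix_ring" where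
  "gm_word w = abs_generic_matrix_ring (Poly_Mapping.single (Word w) 1)"

lemma mpoly_eval_mat_word:
  "mpoly_eval (mat_word generic_matrix w $ j $ k) x = mat_word (\<lambda>i. \<chi> j k. x (i, j, k)) w $ j $ k"
  by (induction w arbitrary: j k)
    (auto simp: mat_word_def mat_def matrix_matrix_mult_def generic_matrix_def
      mpoly_eval_sum mpoly_eval_mult)

lemma gm_scale_word:
  "gm_scale c (gm_word w) = abs_generic_matrix_ring (Poly_Mapping.single (Word w) c)"
  by (simp add: gm_word_def gm_scale.abs_eq free_scale_def mult_single)

lemma gm_sum_words:
  "(\<Sum>w\<in>K. gm_scale (c w) (gm_word w)) =
    abs_generic_matrix_ring (\<Sum>w\<in>K. Poly_Mapping.single (Word w) (c w))"
  by (induction K rule: infinite_finite_induct)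
    (simp_all add: zero_generic_matrix_ring.abs_eq plus_generic_matrix_ring.abs_eq gm_scale_word)

text \<open>A combination of word classes vanishes when the entries of its generic evaluation are
  zero polynomials. These can be tested at all points, and a point is a tuple of complex
  matrices.\<close>

lemma gm_relation_iff:
  "(\<Sum>w\<in>K. gm_scale (c w) (gm_word w)) = (0 :: ('m::finite, 'n) generic_matrix_ring) \<longleftrightarrow>
    (\<forall>(A :: 'n \<Rightarrow> complex^'m^'m) j k. (\<Sum>w\<in>K. c w * mat_word A w $ j $ k) = 0)"
proof -
  let ?p = "\<lambda>j k. \<Sum>w\<in>K. mpoly_const (c w) * mat_word generic_matrix w $ j $ k :: ('n \<times> 'm \<times> 'm) mpoly"
  have "(\<Sum>w\<in>K. gm_scale (c w) (gm_word w)) = (0 :: ('m, 'n) generic_matrix_ring) \<longleftrightarrow>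
      generic_eval (\<Sum>w\<in>K. Poly_Mapping.single (Word w) (c w)) = (0 :: ('n \<times> 'm \<times> 'm) mpoly^'m^'m)"
    by (simp add: gm_sum_words zero_generic_matrix_ring.abs_eq generic_matrix_ring.abs_eq_iff
        polynomial_identities_def)
  also have "\<dots> \<longleftrightarrow> (\<forall>j k. ?p j k = 0)"
    by (simp add: generic_eval_sum generic_eval_single vec_eq_iff mat_mult_entry)
  also have "\<dots> \<longleftrightarrow> (\<forall>(j :: 'm) (k :: 'm) x. (\<Sum>w\<in>K. c w * mat_word (\<lambda>i. \<chi> j k. x (i, j, k)) w $ j $ k) = 0)"
    by (simp add: mpoly_eq_0_iff mpoly_eval_sum mpoly_eval_mult mpoly_eval_mat_word)
  also have "\<dots> \<longleftrightarrow> (\<forall>(A :: 'n \<Rightarrow> complex^'m^'m) j k. (\<Sum>w\<in>K. c w * mat_word A w $ j $ k) = 0)"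
  proof (intro iffI allI)
    fix A :: "'n \<Rightarrow> complex^'m^'m" and j k
    assume "\<forall>(j :: 'm) (k :: 'm) x. (\<Sum>w\<in>K. c w * mat_word (\<lambda>i. \<chi> j k. x (i, j, k)) w $ j $ k) = 0"
    \<comment> \<open>The point is the one whose coordinates are the entries of the given
      matrices.\<close>
    from spec[OF spec[OF spec[OF this, of j], of k], of "\<lambda>(i, j, k). A i $ j $ k"]
    show "(\<Sum>w\<in>K. c w * mat_word A w $ j $ k) = 0"
      by simp
  qed simp
  finally show ?thesis .
qed

text \<open>Each occurrence of the letter \<open>i\<close> contributes one factor
  \<open>t i\<close>, so under the torus action a word has its content as weight.\<close>

lemma mat_word_scaled:
  "mat_word (\<lambda>i. \<chi> j k. t i * A i $ j $ k) w $ j $ k =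
    (\<Prod>i\<in>UNIV. t i ^ count_list w i) * mat_word A w $ j $ k"
  for A :: "'n::finite \<Rightarrow> complex^'m^'m"
proof (induction w arbitrary: j k)
  case Nil
  then show ?case by (simp add: mat_word_def)
next
  case (Cons a w)
  have "(\<Prod>i\<in>UNIV. t i ^ count_list (a # w) i) =
      (\<Prod>i\<in>UNIV. (if i = a then t i else 1) * t i ^ count_list w i)"
    by (intro prod.cong) auto
  also have "\<dots> = t a * (\<Prod>i\<in>UNIV. t i ^ count_list w i)"
    by (simp add: prod.distrib)
  finally have count: "(\<Prod>i\<in>UNIV. t i ^ count_list (a # w) i) =
      t a * (\<Prod>i\<in>UNIV. t i ^ count_list w i)" .
  have step: "mat_word M (a # w) $ j $ k = (\<Sum>l\<in>UNIV. M a $ j $ l * mat_word M w $ l $ k)"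
    for M :: "'n \<Rightarrow> complex^'m^'m"
    by (simp add: mat_word_def matrix_matrix_mult_def)
  show ?case
    unfolding step count Cons.IH by (simp add: sum_distrib_left mult_ac)
qed

text \<open>The relation holds for all rescaled matrices. Grouped by content, it becomes a relation
  between the characters of \<open>t\<close> given by the exponent vectors; these are distinct, so
  each group vanishes by Dedekind.\<close>

lemma gm_relation_multihomogeneous:
  assumes fin: "finite K"
    and rel: "(\<Sum>w\<in>K. gm_scale (c w) (gm_word w)) = (0 :: ('m::finite, 'n::finite) generic_matrix_ring)"
  shows "(\<Sum>w | w \<in> K \<and> count_list w = a. gm_scale (c w) (gm_word w)) =
    (0 :: ('m, 'n) generic_matrix_ring)"
  unfolding gm_relation_iff
proof (intro allI)
  fix A :: "'n \<Rightarrow> complex^'m^'m" and j k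
  let ?I = "count_list ` K"
  let ?s = "\<lambda>a. \<Sum>w | w \<in> K \<and> count_list w = a. c w * mat_word A w $ j $ k"
  let ?\<phi> = "\<lambda>(a :: 'n \<Rightarrow> nat) (t :: 'n \<Rightarrow> complex). \<Prod>i\<in>UNIV. t i ^ a i"
  have "\<forall>a\<in>?I. ?s a = 0"
  proof (rule dedekind_independence[where \<phi> = ?\<phi>])
    show "inj_on ?\<phi> ?I"
    proof (rule inj_onI, rule ext)
      fix a b :: "'n \<Rightarrow> nat" and i assume eq: "?\<phi> a = ?\<phi> b"
      \<comment> \<open>The value 2 in place \<open>i\<close> and 1 elsewhere recovers the exponent
        at \<open>i\<close>.\<close>
      have "?\<phi> c (\<lambda>l. if l = i then 2 else 1) = 2 ^ c i" for c
      proof -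
        have "?\<phi> c (\<lambda>l. if l = i then 2 else 1) = (\<Prod>l\<in>UNIV. if l = i then 2 ^ c l else 1)"
          by (intro prod.cong) auto
        then show ?thesis by simp
      qed
      from this[of a] this[of b] have "(2::complex) ^ a i = 2 ^ b i"
        using fun_cong[OF eq, of "\<lambda>l. if l = i then 2 else 1"] by (simp only:)
      then show "a i = b i"
        by (rule complex_two_power_inject)
    qed
    fix t :: "'n \<Rightarrow> complex"
    have "(\<Sum>a\<in>?I. ?s a * ?\<phi> a t) =
        (\<Sum>a\<in>?I. \<Sum>w | w \<in> K \<and> count_list w = a.
          c w * mat_word (\<lambda>i. \<chi> j k. t i * A i $ j $ k) w $ j $ k)"
      by (intro sum.cong refl) (auto simp: mat_word_scaled sum_distrib_right intro!: sum.cong)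
    also have "\<dots> = (\<Sum>w\<in>K. c w * mat_word (\<lambda>i. \<chi> j k. t i * A i $ j $ k) w $ j $ k)"
      by (rule sum.image_gen[OF fin, symmetric])
    also have "\<dots> = 0"
      using rel unfolding gm_relation_iff by blast
    finally show "(\<Sum>a\<in>?I. ?s a * ?\<phi> a t) = 0" .
  qed (use fin in \<open>auto simp: power_mult_distrib prod.distrib\<close>)
  \<comment> \<open>For a content that no word of \<open>K\<close> has, the sum is empty.\<close>
  moreover have "?s a = 0" if "a \<notin> ?I"
    using that by (intro sum.neutral) auto
  ultimately show "?s a = 0"
    by blast
qed


section \<open>Graded parts of the generic matrix ring\<close>

lemma finite_words: "finite {w :: 'n::finite list. length w = d}"
  using finite_lists_length_eq[of "UNIV :: 'n set" d] by simp

lemma sum_count_list_UNIV: "(\<Sum>i\<in>UNIV. count_list w i) = length w"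
  for w :: "'n::finite list"
  by (intro sum_count_set) auto

lemma finite_words_content: "finite {w :: 'n::finite list. count_list w = a}"
  by (rule finite_subset[OF _ finite_words[of "sum a UNIV"]]) (auto simp flip: sum_count_list_UNIV)

text \<open>A free algebra element is homogeneous of multidegree \<open>a\<close> exactly when it is
  a combination of words with content \<open>a\<close>; the quotient map carries this to
  classes.\<close>

lemma gm_part_eq_span:
  "gm_part a = gm.span (gm_word ` {w :: 'n::finite list. count_list w = a})"
    (is "_ = gm.span (_ ` ?W)")
proof (intro equalityI subsetI)
  fix x :: "('m::finite, 'n) generic_matrix_ring" assume "x \<in> gm_part a"
  then obtain f where f: "f \<in> free_part a" "x = abs_generic_matrix_ring f"
    by (auto simp: gm_part_def)
  let ?K = "letters ` Poly_Mapping.keys f"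
  have inj: "inj_on letters X" for X :: "'n free_monoid set"
    by (rule inj_onI) (rule free_monoid.expand)
  have "f = (\<Sum>w\<in>Poly_Mapping.keys f. Poly_Mapping.single w (Poly_Mapping.lookup f w))"
    by (rule poly_mapping_sum_single)
  also have "\<dots> = (\<Sum>w\<in>?K. Poly_Mapping.single (Word w) (Poly_Mapping.lookup f (Word w)))"
    by (simp add: sum.reindex[OF inj])
  finally have "x = (\<Sum>w\<in>?K. gm_scale (Poly_Mapping.lookup f (Word w)) (gm_word w))"
    unfolding gm_sum_words f(2) by (rule arg_cong)
  also have "\<dots> \<in> gm.span (gm_word ` ?W)"
    using f(1) by (intro gm.span_sum gm.span_scale gm.span_base) (auto simp: free_part_def fun_eq_iff)
  finally show "x \<in> gm.span (gm_word ` ?W)" .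
next
  fix x :: "('m::finite, 'n) generic_matrix_ring" assume "x \<in> gm.span (gm_word ` ?W)"
  then obtain c where "x = (\<Sum>w\<in>?W. gm_scale (c w) (gm_word w))"
    using finite_words_content by (rule gm.span_imageE)
  then have x: "x = abs_generic_matrix_ring (\<Sum>w\<in>?W. Poly_Mapping.single (Word w) (c w))"
    by (simp add: gm_sum_words)
  have "Poly_Mapping.keys (\<Sum>w\<in>?W. Poly_Mapping.single (Word w) (c w)) \<subseteq>
      (\<Union>w\<in>?W. Poly_Mapping.keys (Poly_Mapping.single (Word w) (c w)))"
    by (rule keys_sum)
  also have "\<dots> \<subseteq> Word ` ?W"
    by auto
  finally show "x \<in> gm_part a"
    unfolding gm_part_def x free_part_def by (intro imageI) auto
qed

text \<open>The length of a word is the sum of its letter counts, so words of length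
  \<open>d\<close> are sorted by content into the multidegrees of total \<open>d\<close>.\<close>

lemma gm_degree_part_eq_span:
  "gm_degree_part d =
    (gm.span (gm_word ` {w. length w = d}) :: ('m::finite, 'n::finite) generic_matrix_ring set)"
    (is "_ = gm.span (_ ` ?W)")
proof (rule equalityI)
  have "gm_part a \<subseteq> gm.span (gm_word ` ?W :: ('m, 'n) generic_matrix_ring set)"
    if "(\<Sum>i\<in>UNIV. a i) = d" for a :: "'n \<Rightarrow> nat"
    unfolding gm_part_eq_span using that
    by (intro gm.span_mono image_mono subsetI CollectI) (simp flip: sum_count_list_UNIV)
  then show "gm_degree_part d \<subseteq> (gm.span (gm_word ` ?W) :: ('m, 'n) generic_matrix_ring set)"
    unfolding gm_degree_part_def by (intro gm.span_minimal gm.subspace_span UN_least) simp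
  show "gm.span (gm_word ` ?W) \<subseteq> (gm_degree_part d :: ('m, 'n) generic_matrix_ring set)"
    unfolding gm_degree_part_def
  proof (intro gm.span_mono image_subsetI)
    fix w assume "w \<in> ?W"
    moreover have "gm_word w \<in> (gm_part (count_list w) :: ('m, 'n) generic_matrix_ring set)"
      unfolding gm_part_eq_span by (intro gm.span_base imageI) simp
    ultimately show "gm_word w \<in>
        (\<Union>a\<in>{a. (\<Sum>i\<in>UNIV. a i) = d}. gm_part a :: ('m, 'n) generic_matrix_ring set)"
      by (intro UN_I[of "count_list w"]) (simp_all add: sum_count_list_UNIV)
  qed
qed

lemma finite_contents: "finite {a :: 'n::finite \<Rightarrow> nat. (\<Sum>i\<in>UNIV. a i) = d}"
proof -
  have "{a. (\<Sum>i\<in>UNIV. a i) = d} \<subseteq> (UNIV :: 'n set) \<rightarrow>\<^sub>E {..d}"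
    by (auto intro!: member_le_sum)
  then show ?thesis
    by (rule finite_subset) (intro finite_PiE finite finite_atMost)
qed

text \<open>Word bases chosen in each multidegree unite to a word basis of the whole degree: a
  relation splits by content into relations inside one multidegree. Bases of different multidegrees
  are disjoint, so cardinalities add.\<close>

lemma gm_dim_degree_part:
  "gm.dim (gm_degree_part d :: ('m::finite, 'n::finite) generic_matrix_ring set) =
    (\<Sum>a | (\<Sum>i\<in>UNIV. a i) = d. gm.dim (gm_part a :: ('m, 'n) generic_matrix_ring set))"
proof -
  let ?e = "gm_word :: 'n list \<Rightarrow> ('m, 'n) generic_matrix_ring"
  let ?W = "\<lambda>a. {w :: 'n list. count_list w = a}"
  let ?D = "{a :: 'n \<Rightarrow> nat. (\<Sum>i\<in>UNIV. a i) = d}"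
  have "\<forall>a. \<exists>B\<subseteq>?W a. ?e ` ?W a \<subseteq> gm.span (?e ` B) \<and>
      (\<forall>c. (\<Sum>b\<in>B. gm_scale (c b) (?e b)) = 0 \<longrightarrow> (\<forall>b\<in>B. c b = 0))"
    by (intro allI gm.basis_family finite_words_content)
  from choice[OF this] obtain B where "\<forall>a. B a \<subseteq> ?W a \<and> ?e ` ?W a \<subseteq> gm.span (?e ` B a) \<and>
      (\<forall>c. (\<Sum>b\<in>B a. gm_scale (c b) (?e b)) = 0 \<longrightarrow> (\<forall>b\<in>B a. c b = 0))" ..
  then have B: "B a \<subseteq> ?W a" "?e ` ?W a \<subseteq> gm.span (?e ` B a)"
      "(\<Sum>b\<in>B a. gm_scale (c b) (?e b)) = 0 \<Longrightarrow> \<forall>b\<in>B a. c b = 0" for a c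
    by blast+
  have fin: "finite (B a)" for a
    using B(1) finite_words_content by (rule finite_subset)
  have dim_part: "gm.dim (gm_part a :: ('m, 'n) generic_matrix_ring set) = card (B a)" for a
    unfolding gm_part_eq_span
  proof (rule gm.dim_eq_card_family[OF fin, where e = ?e])
    show "?e ` B a \<subseteq> gm.span (?e ` ?W a)"
      using B(1) by (intro subset_trans[OF image_mono gm.span_superset])
    show "gm.span (?e ` ?W a) \<subseteq> gm.span (?e ` B a)"
      using B(2) by (intro gm.span_minimal gm.subspace_span)
  qed (use B(3) in blast)
  let ?B = "\<Union>a\<in>?D. B a"
  have fin_union: "finite ?B"
    using finite_contents fin by (rule finite_UN_I)
  have "gm.dim (gm_degree_part d :: ('m, 'n) generic_matrix_ring set) = card ?B"
    unfolding gm_degree_part_eq_span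
  proof (rule gm.dim_eq_card_family[OF fin_union, where e = ?e])
    have "?B \<subseteq> {w. length w = d}"
    proof
      fix w assume "w \<in> ?B"
      then obtain a where "a \<in> ?D" "w \<in> B a" by blast
      then show "w \<in> {w. length w = d}"
        using B(1)[of a] sum_count_list_UNIV[of w] by auto
    qed
    then show "?e ` ?B \<subseteq> gm.span (?e ` {w. length w = d})"
      by (intro subset_trans[OF image_mono gm.span_superset])
    have "?e w \<in> gm.span (?e ` ?B)" if "length w = d" for w
    proof -
      have "?e w \<in> gm.span (?e ` B (count_list w))"
        using B(2) by blast
      also have "\<dots> \<subseteq> gm.span (?e ` ?B)"
        using that by (intro gm.span_mono image_mono UN_upper) (simp add: sum_count_list_UNIV)
      finally show ?thesis .
    qed
    then show "gm.span (?e ` {w. length w = d}) \<subseteq> gm.span (?e ` ?B)"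
      by (intro gm.span_minimal gm.subspace_span) auto
    fix c assume rel: "(\<Sum>b\<in>?B. gm_scale (c b) (?e b)) = 0"
    show "\<forall>b\<in>?B. c b = 0"
    proof
      fix b assume "b \<in> ?B"
      then obtain a where a: "a \<in> ?D" "b \<in> B a" by blast
      \<comment> \<open>The component of content \<open>a\<close> of the relation thus runs over
        \<open>B a\<close> alone, where independence is known.\<close>
      have "{w \<in> ?B. count_list w = a} = B a"
        using B(1) a(1) by blast
      then have "(\<Sum>b\<in>B a. gm_scale (c b) (?e b)) = 0"
        using gm_relation_multihomogeneous[OF fin_union rel, of a] by simp
      then show "c b = 0"
        using B(3) a(2) by blast
    qed
  qed
  also have "\<dots> = (\<Sum>a\<in>?D. card (B a))"
  proof (rule card_UN_disjoint)
    show "\<forall>a\<in>?D. \<forall>b\<in>?D. a \<noteq> b \<longrightarrow> B a \<inter> B b = {}"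
      using B(1) by blast
  qed (use fin finite_contents in auto)
  finally show ?thesis
    by (simp add: dim_part)
qed


section \<open>The span of the matrix product states\<close>

lemma pure_tensor_axis:
  fixes v w :: "'n::finite list"
  shows "pure_tensor (map (\<lambda>i. axis i 1) v) w = (if v = w then 1 else 0)"
proof (cases "length v = length w")
  case True
  have "(\<Prod>k<length v. (axis (v ! k) 1 :: complex^'n) $ (w ! k)) = (if v = w then 1 else 0)"
  proof (cases "v = w")
    case False
    then obtain k where "k < length v" "v ! k \<noteq> w ! k"
      using True nth_equalityI by blast
    then show ?thesis
      using False by (auto simp: axis_def intro!: prod_zero bexI[of _ k])
  qed (simp add: axis_def)
  then show ?thesis
    using True by (simp add: pure_tensor_def)
qed (auto simp: pure_tensor_def)

lemma hMPS_map_apply: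
  "hMPS_map d X A w = (if length w = d then trace (X ** mat_word A w) else 0)"
proof -
  have "hMPS_map d X A w =
      (\<Sum>v | length v = d. if v = w then trace (X ** mat_word A v) else 0)"
    by (auto simp: hMPS_map_def sum_fun_apply tensor_scale_def pure_tensor_axis intro!: sum.cong)
  then show ?thesis
    by (simp add: finite_words)
qed

text \<open>Pairing with the matrix unit that has its 1 in row \<open>k\<close> and column
  \<open>j\<close> picks out one entry; this is the nondegeneracy of the trace form.\<close>

lemma trace_mult_single:
  "trace ((\<chi> r s. if r = k \<and> s = j then 1 else 0) ** M) = M $ j $ k"
  for M :: "complex^'m^'m"
proof -
  have "trace ((\<chi> r s. if r = k \<and> s = j then 1 else 0) ** M) =
      (\<Sum>r\<in>UNIV. \<Sum>s\<in>UNIV. if s = j then if r = k then M $ s $ r else 0 else 0)"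
    unfolding trace_def matrix_matrix_mult_def vec_lambda_beta by (intro sum.cong refl) simp
  then show ?thesis
    by simp
qed

text \<open>The sum over coordinates is the trace of \<open>X\<close> times the evaluated
  combination. It is linear in the entries of that matrix, and taking \<open>X\<close> to be matrix
  units recovers each entry.\<close>

lemma gm_relation_iff_tensor:
  fixes c :: "'n::finite list \<Rightarrow> complex"
  assumes K: "K \<subseteq> {w. length w = d}"
  shows "(\<Sum>w\<in>K. gm_scale (c w) (gm_word w)) = (0 :: ('m::finite, 'n) generic_matrix_ring) \<longleftrightarrow>
    (\<forall>(X :: complex^'m^'m) A. (\<Sum>w\<in>K. c w * hMPS_map d X A w) = 0)"
proof -
  have map: "(\<Sum>w\<in>K. c w * hMPS_map d X A w) = (\<Sum>w\<in>K. c w * trace (X ** mat_word A w))"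
    for X :: "complex^'m^'m" and A
    using K by (intro sum.cong) (auto simp: hMPS_map_apply)
  show ?thesis
    unfolding gm_relation_iff map
  proof (intro iffI allI)
    fix X :: "complex^'m^'m" and A :: "'n \<Rightarrow> complex^'m^'m"
    assume *: "\<forall>(A :: 'n \<Rightarrow> complex^'m^'m) j k. (\<Sum>w\<in>K. c w * mat_word A w $ j $ k) = 0"
    have "(\<Sum>w\<in>K. c w * trace (X ** mat_word A w)) =
        (\<Sum>w\<in>K. \<Sum>r\<in>UNIV. \<Sum>s\<in>UNIV. X $ r $ s * (c w * mat_word A w $ s $ r))"
      by (simp add: trace_def matrix_matrix_mult_def sum_distrib_left mult_ac)
    also have "\<dots> = (\<Sum>r\<in>UNIV. \<Sum>s\<in>UNIV. \<Sum>w\<in>K. X $ r $ s * (c w * mat_word A w $ s $ r))"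
      unfolding sum.swap[of _ UNIV K] ..
    also have "\<dots> = (\<Sum>r\<in>UNIV. \<Sum>s\<in>UNIV. X $ r $ s * (\<Sum>w\<in>K. c w * mat_word A w $ s $ r))"
      by (simp only: sum_distrib_left)
    also have "\<dots> = 0"
      using * by simp
    finally show "(\<Sum>w\<in>K. c w * trace (X ** mat_word A w)) = 0" .
  next
    fix A :: "'n \<Rightarrow> complex^'m^'m" and j k
    assume "\<forall>(X :: complex^'m^'m) A. (\<Sum>w\<in>K. c w * trace (X ** mat_word A w)) = 0"
    from spec[OF spec[OF this, of "\<chi> r s. if r = k \<and> s = j then 1 else 0"], of A]
    show "(\<Sum>w\<in>K. c w * mat_word A w $ j $ k) = 0"
      by (simp add: trace_mult_single)
  qed
qed

section \<open>Zariski closure and linear relations\<close>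

lemma zariski_closure_superset: "S \<subseteq> tensor_space d \<Longrightarrow> S \<subseteq> zariski_closure d S"
  by (auto simp: zariski_closure_def)

text \<open>A linear form is a polynomial, so passing to the closure destroys no linear relation
  between coordinates.\<close>

lemma zariski_closure_linear:
  assumes "T \<in> zariski_closure d S" and S: "\<And>U. U \<in> S \<Longrightarrow> (\<Sum>b\<in>B. c b * U b) = 0"
  shows "(\<Sum>b\<in>B. c b * T b) = 0"
proof -
  let ?p = "\<Sum>b\<in>B. mpoly_const (c b) * mpoly_var b"
  have eval: "mpoly_eval ?p U = (\<Sum>b\<in>B. c b * U b)" for U
    by (simp add: mpoly_eval_sum mpoly_eval_mult)
  then have "\<forall>U\<in>S. mpoly_eval ?p U = 0"
    using S by simp
  then have "mpoly_eval ?p T = 0"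
    using assms(1) unfolding zariski_closure_def by blast
  then show ?thesis
    unfolding eval .
qed

text \<open>Words whose classes form a basis of the degree part serve as coordinates on the span.
  Their independence and the expressions for all other words are both relations in the ring, which
  transfer to the tensors.\<close>

lemma dim_span_hMPS:
  "tensor.dim (tensor.span (hMPS TYPE('m::finite) d :: 'n::finite tensor set)) =
    gm.dim (gm_degree_part d :: ('m, 'n) generic_matrix_ring set)"
proof -
  let ?e = "gm_word :: 'n list \<Rightarrow> ('m, 'n) generic_matrix_ring"
  let ?W = "{w :: 'n list. length w = d}"
  let ?I = "{hMPS_map d X A | (X :: complex^'m^'m) (A :: 'n \<Rightarrow> complex^'m^'m). True}"
  have sub: "?I \<subseteq> hMPS TYPE('m) d"
    unfolding hMPS_def
    by (rule zariski_closure_superset) (auto simp: tensor_space_def hMPS_map_apply)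
  from gm.basis_family[OF finite_words, where e = ?e]
  obtain B where "B \<subseteq> ?W \<and> ?e ` ?W \<subseteq> gm.span (?e ` B) \<and>
      (\<forall>c. (\<Sum>b\<in>B. gm_scale (c b) (?e b)) = 0 \<longrightarrow> (\<forall>b\<in>B. c b = 0))" ..
  then have B: "B \<subseteq> ?W" "?e ` ?W \<subseteq> gm.span (?e ` B)"
      "(\<Sum>b\<in>B. gm_scale (c b) (?e b)) = 0 \<Longrightarrow> \<forall>b\<in>B. c b = 0" for c
    by blast+
  have fin: "finite B"
    using B(1) finite_words by (rule finite_subset)
  have "gm.dim (gm_degree_part d :: ('m, 'n) generic_matrix_ring set) = card B"
    unfolding gm_degree_part_eq_span
  proof (rule gm.dim_eq_card_family[OF fin, where e = ?e])
    show "?e ` B \<subseteq> gm.span (?e ` ?W)"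
      using B(1) by (intro subset_trans[OF image_mono gm.span_superset])
    show "gm.span (?e ` ?W) \<subseteq> gm.span (?e ` B)"
      using B(2) by (intro gm.span_minimal gm.subspace_span)
  qed (use B(3) in blast)
  moreover have "tensor.dim (tensor.span (hMPS TYPE('m) d :: 'n tensor set)) = card B"
  proof (rule tensor_dim_span[OF fin])
    fix c assume c: "\<And>T :: 'n tensor. T \<in> hMPS TYPE('m) d \<Longrightarrow> (\<Sum>b\<in>B. c b * T b) = 0"
    have "(\<Sum>w\<in>B. c w * hMPS_map d X A w) = 0" for X :: "complex^'m^'m" and A
      using sub by (intro c) blast
    then show "\<forall>b\<in>B. c b = 0"
      by (intro B(3)) (simp add: gm_relation_iff_tensor[OF B(1)])
  next
    fix w :: "'n list"
    show "\<exists>c. \<forall>T\<in>hMPS TYPE('m) d. T w = (\<Sum>b\<in>B. c b * T b)"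
    proof (cases "length w = d")
      case False
      then show ?thesis
        \<comment> \<open>Tensors of order \<open>d\<close> vanish at words of other lengths, so
          zero coefficients do.\<close>
        by (intro exI[of _ "\<lambda>_. 0"]) (auto simp: hMPS_def zariski_closure_def tensor_space_def)
    next
      case True
      then have "?e w \<in> gm.span (?e ` B)"
        using B(2) by blast
      then obtain c where c: "?e w = (\<Sum>b\<in>B. gm_scale (c b) (?e b))"
        using fin by (rule gm.span_imageE)
      show ?thesis
      proof (cases "w \<in> B")
        case w: True
        have "T w = (\<Sum>b\<in>B. (if b = w then 1 else 0) * T b)" for T :: "'n tensor"
        proof -
          have "(\<Sum>b\<in>B. (if b = w then 1 else 0) * T b) = (\<Sum>b\<in>B. if b = w then T b else 0)"
            by (intro sum.cong) auto
          then show ?thesis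
            using w fin by simp
        qed
        then show ?thesis
          by (intro exI[of _ "\<lambda>b. if b = w then 1 else 0"] ballI)
      next
        case w: False
        \<comment> \<open>The coefficient -1 at the new index \<open>w\<close> turns the expression
          for its class into a relation.\<close>
        define c' where "c' = c(w := -1)"
        \<comment> \<open>An arbitrary \<open>scale\<close> lets the same splitting serve classes in
          the ring and coordinates of tensors.\<close>
        have sum_c': "(\<Sum>b\<in>insert w B. scale (c' b) (f b)) =
            scale (-1) (f w) + (\<Sum>b\<in>B. scale (c b) (f b))"
          for scale :: "complex \<Rightarrow> 'v \<Rightarrow> 'v::ab_group_add" and f
        proof -
          have "(\<Sum>b\<in>B. scale (c' b) (f b)) = (\<Sum>b\<in>B. scale (c b) (f b))"
            using w by (intro sum.cong refl) (auto simp: c'_def)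
          then show ?thesis
            using w fin by (simp add: c'_def)
        qed
        have words: "insert w B \<subseteq> ?W"
          using B(1) True by simp
        have "(\<Sum>b\<in>insert w B. gm_scale (c' b) (?e b)) = 0"
          unfolding sum_c' c[symmetric] by simp
        then have "(\<Sum>b\<in>insert w B. c' b * hMPS_map d X A b) = 0" for X :: "complex^'m^'m" and A
          unfolding gm_relation_iff_tensor[OF words] by blast
        then have "(\<Sum>b\<in>insert w B. c' b * T b) = 0" if "T \<in> hMPS TYPE('m) d" for T
          using that unfolding hMPS_def by (elim zariski_closure_linear) blast
        then have "T w = (\<Sum>b\<in>B. c b * T b)" if "T \<in> hMPS TYPE('m) d" for T
          using that sum_c'[of "(*)" T] by simp
        then show ?thesis
          by (intro exI[of _ c] ballI)
      qed
    qed
  qed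
  ultimately show ?thesis by simp
qed

section \<open>The Hilbert series with all variables equal\<close>

lemma hilbert_series_X:
  fixes R :: "('n::finite \<Rightarrow> nat) \<Rightarrow> 'v::ab_group_add set"
  shows "hilbert_series scal R (\<lambda>_. fps_X) =
    Abs_fps (\<lambda>d. \<Sum>a | (\<Sum>i\<in>UNIV. a i) = d. int (vector_space.dim scal (R a)))"
  unfolding hilbert_series_def
proof (rule infsumI)
  let ?D = "\<lambda>d. {a :: 'n \<Rightarrow> nat. (\<Sum>i\<in>UNIV. a i) = d}"
  let ?f = "\<lambda>a. of_nat (vector_space.dim scal (R a)) * (\<Prod>i\<in>UNIV. fps_X ^ a i) :: int fps"
  let ?g = "Abs_fps (\<lambda>d. \<Sum>a\<in>?D d. int (vector_space.dim scal (R a)))"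
  \<comment> \<open>The substituted monomial is the power of \<open>fps_X\<close> given by the total
    degree, so it contributes to one coefficient only.\<close>
  have nth: "fps_nth (?f a) d = (if a \<in> ?D d then int (vector_space.dim scal (R a)) else 0)" for a d
  proof -
    have "?f a = fps_const (int (vector_space.dim scal (R a))) * fps_X ^ (\<Sum>i\<in>UNIV. a i)"
      by (simp add: power_sum fps_of_nat)
    then show ?thesis
      by auto
  qed
  have "(sum ?f \<longlongrightarrow> ?g) (finite_subsets_at_top UNIV)"
  proof (subst tendsto_fps_iff, intro allI)
    fix d
    \<comment> \<open>Adic convergence is eventual equality of each coefficient. Every finite set
      containing the finitely many exponents of total degree \<open>d\<close> already yields the
      final value.\<close>
    show "\<forall>\<^sub>F F in finite_subsets_at_top UNIV. fps_nth (sum ?f F) d = fps_nth ?g d"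
      unfolding eventually_finite_subsets_at_top
    proof (intro exI conjI allI impI)
      fix F :: "('n \<Rightarrow> nat) set" assume F: "finite F \<and> ?D d \<subseteq> F \<and> F \<subseteq> UNIV"
      have "fps_nth (sum ?f F) d =
          (\<Sum>a\<in>F. if a \<in> ?D d then int (vector_space.dim scal (R a)) else 0)"
        unfolding fps_sum_nth nth ..
      also have "\<dots> = (\<Sum>a\<in>?D d. int (vector_space.dim scal (R a)))"
        using F by (intro sum.mono_neutral_cong_right) auto
      finally show "fps_nth (sum ?f F) d = fps_nth ?g d"
        by simp
    qed (use finite_contents in auto)
  qed
  then show "(?f has_sum ?g) UNIV"
    by (simp add: has_sum_def)
qed

theorem corollary3p3:
  shows "(\<forall>d. tensor.dim (tensor.span (hMPS TYPE('m::finite) d :: 'n::finite tensor set)) =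
            gm.dim (gm_degree_part d :: ('m, 'n) generic_matrix_ring set)) \<and>
         Abs_fps (\<lambda>d. int (tensor.dim (tensor.span (hMPS TYPE('m) d :: 'n tensor set)))) =
            hilbert_series gm_scale (gm_part :: ('n \<Rightarrow> nat) \<Rightarrow> ('m, 'n) generic_matrix_ring set)
              (\<lambda>_. fps_X)"
  \<comment> \<open>Both series become the one whose coefficients sum the dimensions of the
    multigraded parts by total degree.\<close>
  unfolding hilbert_series_X dim_span_hMPS gm_dim_degree_part by simp

end
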